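(* The extreme points of the closed unit ball of $\mathcal{L}(^{2}\ell_{\infty}^{2}(\mathbb{R}))$ are exactly the following bilinear forms (in the variables $x=(x_1,x_2)$, $y=(y_1,y_2)$): $$\pm x_{1}y_{1},\quad \pm x_{2}y_{1},\quad \pm x_{1}y_{2},\quad \pm x_{2}y_{2},$$ $$\tfrac{1}{2}\left(\pm x_{1}y_{1}\pm x_{2}y_{1}\pm x_{1}y_{2}\mp x_{2}y_{2}\right),$$ $$\tfrac{1}{2}\left(\mp x_{1}y_{1}\pm x_{2}y_{1}\pm x_{1}y_{2}\pm x_{2}y_{2}\right),$$ $$\tfrac{1}{2}\left(\pm x_{1}y_{1}\mp x_{2}y_{1}\pm x_{1}y_{2}\pm x_{2}y_{2}\right),$$ $$\tfrac{1}{2}\left(\pm x_{1}y_{1}\pm x_{2}y_{1}\mp x_{1}y_{2}\pm x_{2}y_{2}\right),$$ where within each of the last four expressions the signs are linked (all upper signs or all lower signs are taken simultaneously).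
   Context: $\ell_\infty^2(\mathbb{R})$ is $\mathbb{R}^2$ with the sup norm. $\mathcal{L}(^{2}\ell_{\infty}^{2}(\mathbb{R}))$ is the space of all bilinear forms $T:\ell_{\infty}^{2}(\mathbb{R})\times\ell_{\infty}^{2}(\mathbb{R})\to\mathbb{R}$ with norm $\|T\|=\sup\{|T(x,y)|:\|x\|_\infty\le 1,\|y\|_\infty\le 1\}$. For a convex subset $A$ of a Banach space, $x\in A$ is an extreme point of $A$ if $y,z\in A$ with $x=\frac{y+z}{2}$ implies $y=z$. *)

theory Defs
  imports "HOL-Analysis.Analysis"
begin

text \<open>
  The space \<open>\<ell>\<^sub>\<infinity>\<^sup>2(\<real>)\<close> is the type \<^typ>\<open>real ^ 2\<close> with the library's sup norm
  \<^const>\<open>infnorm\<close> in place of the Euclidean \<^const>\<open>norm\<close>.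
\<close>

lemma infnorm_real2: "infnorm (x :: real ^ 2) = max \<bar>x $ 1\<bar> \<bar>x $ 2\<bar>"
proof -
  have B: "(Basis :: (real ^ 2) set) = {axis 1 1, axis 2 1}"
    by (auto simp: Basis_vec_def UNIV_2)
  have "{\<bar>x \<bullet> b\<bar> | b. b \<in> Basis} = {\<bar>x $ 1\<bar>, \<bar>x $ 2\<bar>}"
    unfolding Setcompr_eq_image B by (simp add: inner_axis)
  then show ?thesis
    unfolding infnorm_def by (simp add: cSup_eq_Max)
qed

typedef bilin = "{T :: real ^ 2 \<Rightarrow> real ^ 2 \<Rightarrow> real. bilinear T}"
  morphisms bilin_apply Bilin
proof
  show "(\<lambda>x y. 0) \<in> {T :: real ^ 2 \<Rightarrow> real ^ 2 \<Rightarrow> real. bilinear T}"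
    by (simp add: bilinear_def linear_iff)
qed

setup_lifting type_definition_bilin

lemma bilinear_bilin_apply: "bilinear (bilin_apply T)"
  using bilin_apply by simp

lemma bilin_eqI: "(\<And>x y. bilin_apply S x y = bilin_apply T x y) \<Longrightarrow> S = T"
  by (metis bilin_apply_inject ext)

instantiation bilin :: real_vector
begin

lift_definition zero_bilin :: bilin is "\<lambda>x y. 0"
  by (simp add: bilinear_def linear_iff)

lift_definition uminus_bilin :: "bilin \<Rightarrow> bilin" is "\<lambda>T x y. - T x y"
  by (simp add: bilinear_def linear_iff)

lift_definition plus_bilin :: "bilin \<Rightarrow> bilin \<Rightarrow> bilin" is "\<lambda>S T x y. S x y + T x y"
  by (simp add: bilinear_def linear_iff algebra_simps)

lift_definition minus_bilin :: "bilin \<Rightarrow> bilin \<Rightarrow> bilin" is "\<lambda>S T x y. S x y - T x y"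
  by (simp add: bilinear_def linear_iff algebra_simps)

lift_definition scaleR_bilin :: "real \<Rightarrow> bilin \<Rightarrow> bilin" is "\<lambda>r T x y. r * T x y"
  by (simp add: bilinear_def linear_iff algebra_simps)

instance
  by standard (transfer; simp add: algebra_simps)+

end

lemmas bilin_apply_simps [simp] =
  zero_bilin.rep_eq uminus_bilin.rep_eq plus_bilin.rep_eq minus_bilin.rep_eq scaleR_bilin.rep_eq

lemma bdd_above_bilin_apply:
  "bdd_above ((\<lambda>(x, y). \<bar>bilin_apply T x y\<bar>) `
    ({x. infnorm x \<le> 1} \<times> {y. infnorm y \<le> 1}))"
proof -
  obtain B where B: "B > 0" "\<And>x y. norm (bilin_apply T x y) \<le> B * norm x * norm y"
    using bilinear_bounded_pos[OF bilinear_bilin_apply[of T]] by blast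
  have n: "norm x \<le> sqrt 2" if "infnorm x \<le> 1" for x :: "real ^ 2"
    using norm_le_infnorm[of x] that
    by simp (meson mult_left_le order_trans real_sqrt_ge_0_iff zero_le_numeral)
  have "\<bar>bilin_apply T x y\<bar> \<le> B * sqrt 2 * sqrt 2" if "infnorm x \<le> 1" "infnorm y \<le> 1" for x y
  proof -
    have "B * norm x * norm y \<le> B * sqrt 2 * sqrt 2"
      using n[OF that(1)] n[OF that(2)] B(1) by (intro mult_mono) auto
    then show ?thesis using B(2)[of x y] by simp
  qed
  then show ?thesis
    by (intro bdd_aboveI[where M = "B * sqrt 2 * sqrt 2"]) auto
qed

instantiation bilin :: real_normed_vector
begin

definition norm_bilin :: "bilin \<Rightarrow> real" where
  "norm_bilin T = (SUP (x, y) \<in> {x. infnorm x \<le> 1} \<times> {y. infnorm y \<le> 1}. \<bar>bilin_apply T x y\<bar>)"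

definition dist_bilin :: "bilin \<Rightarrow> bilin \<Rightarrow> real" where
  "dist_bilin S T = norm (S - T)"

definition sgn_bilin :: "bilin \<Rightarrow> bilin" where
  "sgn_bilin T = T /\<^sub>R norm T"

definition uniformity_bilin :: "(bilin \<times> bilin) filter" where
  "uniformity_bilin = (INF e\<in>{0 <..}. principal {(S, T). dist S T < e})"

definition open_bilin :: "bilin set \<Rightarrow> bool" where
  "open_bilin U = (\<forall>S\<in>U. \<forall>\<^sub>F (S', T) in uniformity. S' = S \<longrightarrow> T \<in> U)"

instance
proof
  have upper: "\<bar>bilin_apply T x y\<bar> \<le> norm T" if "infnorm x \<le> 1" "infnorm y \<le> 1" for T x y
    using cSUP_upper[OF _ bdd_above_bilin_apply[of T], of "(x, y)"] that
    by (simp add: norm_bilin_def)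
  have least: "norm T \<le> B"
    if "\<And>x y. infnorm x \<le> 1 \<Longrightarrow> infnorm y \<le> 1 \<Longrightarrow> \<bar>bilin_apply T x y\<bar> \<le> B" for T B
    unfolding norm_bilin_def
    using that by (intro cSUP_least) (auto intro: exI[of _ 0] simp: infnorm_0)
  have nn: "0 \<le> norm T" for T :: bilin
    using upper[of 0 0 T] by (simp add: infnorm_0)
  fix S T :: bilin and r :: real
  show "dist S T = norm (S - T)" by (rule dist_bilin_def)
  show "sgn T = T /\<^sub>R norm T" by (rule sgn_bilin_def)
  show "uniformity = (INF e\<in>{0 <..}. principal {(S :: bilin, T). dist S T < e})"
    by (rule uniformity_bilin_def)
  show "open U = (\<forall>S\<in>U. \<forall>\<^sub>F (S', T) in uniformity. S' = S \<longrightarrow> T \<in> U)" for U :: "bilin set"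
    by (rule open_bilin_def)
  show "norm (S + T) \<le> norm S + norm T"
    by (rule least) (use upper in \<open>force intro: order_trans[OF abs_triangle_ineq] add_mono\<close>)
  have scale_le: "norm (r *\<^sub>R T) \<le> \<bar>r\<bar> * norm T" for r and T :: bilin
    by (rule least) (auto simp: abs_mult intro!: mult_left_mono upper)
  show scale: "norm (r *\<^sub>R T) = \<bar>r\<bar> * norm T"
  proof (cases "r = 0")
    case True
    then show ?thesis using scale_le[of 0 T] nn[of 0] by simp
  next
    case False
    have "\<bar>r\<bar> * norm T \<le> norm (r *\<^sub>R T)"
      using scale_le[of "inverse r" "r *\<^sub>R T"] False by (simp add: field_simps)
    then show ?thesis using scale_le[of r T] by simp
  qed
  show "norm T = 0 \<longleftrightarrow> T = 0"
  proof
    assume n0: "norm T = 0"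
    have small: "bilin_apply T x y = 0" if "infnorm x \<le> 1" "infnorm y \<le> 1" for x y
      using upper[OF that, of T] n0 by simp
    have unit: "infnorm (x /\<^sub>R (infnorm x + 1)) \<le> 1" for x :: "real ^ 2"
      using infnorm_pos_le[of x] by (simp add: infnorm_mul field_simps)
    show "T = 0"
    proof (rule bilin_eqI)
      fix x y :: "real ^ 2"
      have "bilin_apply T (x /\<^sub>R (infnorm x + 1)) (y /\<^sub>R (infnorm y + 1)) = 0"
        by (intro small unit)
      then have "bilin_apply T x y = 0"
        using infnorm_pos_le[of x] infnorm_pos_le[of y]
        by (simp add: bilinear_lmul[OF bilinear_bilin_apply] bilinear_rmul[OF bilinear_bilin_apply]
            add_nonneg_eq_0_iff)
      then show "bilin_apply T x y = bilin_apply 0 x y" by simp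
    qed
  next
    assume "T = 0"
    then show "norm T = 0" using least[of 0 0] nn[of 0] by simp
  qed
qed

end

text \<open>
  The library's \<^const>\<open>extreme_point_of\<close> is phrased with open segments; on convex sets it is
  the midpoint definition.
\<close>

lemma extreme_point_of_iff_midpoint:
  fixes A :: "'a::real_vector set"
  assumes "convex A"
  shows "x extreme_point_of A \<longleftrightarrow>
    x \<in> A \<and> (\<forall>y\<in>A. \<forall>z\<in>A. x = (1/2) *\<^sub>R (y + z) \<longrightarrow> y = z)"
proof (intro iffI conjI ballI impI)
  assume x: "x extreme_point_of A"
  then show "x \<in> A" by (simp add: extreme_point_of_def)
  fix y z assume yz: "y \<in> A" "z \<in> A" "x = (1/2) *\<^sub>R (y + z)"
  then have "x \<notin> open_segment y z" using x by (simp add: extreme_point_of_def)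
  moreover have "x = midpoint y z" using yz(3) by (simp add: midpoint_def)
  ultimately show "y = z" by simp
next
  assume R: "x \<in> A \<and> (\<forall>y\<in>A. \<forall>z\<in>A. x = (1/2) *\<^sub>R (y + z) \<longrightarrow> y = z)"
  have False if yz: "y \<in> A" "z \<in> A" and o: "x \<in> open_segment y z" for y z
  proof -
    obtain u where u: "0 < u" "u < 1" "x = (1 - u) *\<^sub>R y + u *\<^sub>R z" and "y \<noteq> z"
      using o by (auto simp: in_segment)
    define e where "e = min u (1 - u)"
    have e: "0 < e" "e \<le> u" "e \<le> 1 - u" using u by (auto simp: e_def)
    define w where "w = e *\<^sub>R (z - y)"
    have "x - w = (1 - (u - e)) *\<^sub>R y + (u - e) *\<^sub>R z"
      "x + w = (1 - (u + e)) *\<^sub>R y + (u + e) *\<^sub>R z"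
      unfolding w_def u(3) by (simp_all add: algebra_simps)
    then have "x - w \<in> A" "x + w \<in> A"
      using assms yz e u by (auto intro!: convexD_alt)
    moreover have "x = (1/2) *\<^sub>R ((x - w) + (x + w))"
      by (simp flip: scaleR_2)
    ultimately have "x - w = x + w" using R by blast
    then have "2 *\<^sub>R w = 0" by (simp add: scaleR_2 algebra_simps)
    then show False using e \<open>y \<noteq> z\<close> by (simp add: w_def)
  qed
  then show "x extreme_point_of A" using R by (auto simp: extreme_point_of_def)
qed

end

theory Submission
  imports Defs
begin

text \<open>
  The norm of a bilinear form on the square is attained at a pair of vertices, so in the four
  linear coordinates \<open>T(1, \<plusminus>1)(1, \<plusminus>1)\<close> the closed unit ball is the cube \<open>[-1, 1]\<^sup>4\<close>. Its extreme
  points are therefore the 16 forms whose vertex values are all \<open>\<plusminus>1\<close>, and solving for the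
  coefficients gives the list.
\<close>

text \<open>With \<open>y = T + U\<close> and \<open>z = T - U\<close>, the pairs with midpoint
  \<open>T\<close> are exactly the symmetric perturbations of \<open>T\<close>, where
  \<open>U\<close> is half of \<open>y - z\<close>. Extremality becomes a condition on a single
  \<open>U\<close>, which suits the linear norm criterion below.\<close>

lemma extreme_point_of_cball_iff:
  fixes T :: "'a::real_normed_vector"
  shows "T extreme_point_of cball 0 1 \<longleftrightarrow>
    norm T \<le> 1 \<and> (\<forall>U. norm (T + U) \<le> 1 \<and> norm (T - U) \<le> 1 \<longrightarrow> U = 0)"
proof -
  have "U = 0" if R: "\<forall>y\<in>cball 0 1. \<forall>z\<in>cball 0 1. T = (1/2) *\<^sub>R (y + z) \<longrightarrow> y = z"
    and U: "norm (T + U) \<le> 1" "norm (T - U) \<le> 1" for U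
  proof -
    have "T = (1/2) *\<^sub>R ((T + U) + (T - U))"
      by (simp flip: scaleR_2)
    then have "T + U = T - U"
      using R U by (metis mem_cball_0)
    then have "2 *\<^sub>R U = 0"
      by (simp add: scaleR_2 algebra_simps)
    then show ?thesis by simp
  qed
  moreover have "y = z" if R: "\<forall>U. norm (T + U) \<le> 1 \<and> norm (T - U) \<le> 1 \<longrightarrow> U = 0"
    and yz: "norm y \<le> 1" "norm z \<le> 1" "T = (1/2) *\<^sub>R (y + z)" for y z
  proof -
    have "(1/2) *\<^sub>R x + (1/2) *\<^sub>R x = x" for x :: 'a
      by (simp flip: scaleR_add_left)
    then have "T + (1/2) *\<^sub>R (y - z) = y" "T - (1/2) *\<^sub>R (y - z) = z"
      unfolding yz(3) by (simp_all add: algebra_simps)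
    then have "(1/2) *\<^sub>R (y - z) = 0"
      using R yz by metis
    then show ?thesis by simp
  qed
  ultimately show ?thesis
    unfolding extreme_point_of_iff_midpoint[OF convex_cball] by auto
qed

lift_definition bform :: "real \<Rightarrow> real \<Rightarrow> real \<Rightarrow> real \<Rightarrow> bilin" is
  "\<lambda>a b c d x y. a * (x $ 1 * y $ 1) + b * (x $ 2 * y $ 1) + c * (x $ 1 * y $ 2) + d * (x $ 2 * y $ 2)"
  by (simp add: bilinear_def linear_iff algebra_simps)

lemma bform_add: "bform a b c d + bform a' b' c' d' = bform (a + a') (b + b') (c + c') (d + d')"
  and bform_diff: "bform a b c d - bform a' b' c' d' = bform (a - a') (b - b') (c - c') (d - d')"
  by (rule bilin_eqI; simp add: bform.rep_eq algebra_simps)+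

lemma bform_eq_iff:
  "bform a b c d = bform a' b' c' d' \<longleftrightarrow> a = a' \<and> b = b' \<and> c = c' \<and> d = d'" (is "?L = ?R")
proof
  assume ?L
  then have "bilin_apply (bform a b c d) (axis i 1) (axis j 1) =
      bilin_apply (bform a' b' c' d') (axis i 1) (axis j 1)" for i j
    by simp
  from this[of 1 1] this[of 2 1] this[of 1 2] this[of 2 2] show ?R
    by (simp_all add: bform.rep_eq axis_def)
qed simp

lemma bform_zero: "bform 0 0 0 0 = 0"
  by (rule bilin_eqI) (simp add: bform.rep_eq)

lemma bform_cases:
  obtains a b c d where "T = bform a b c d"
proof
  let ?t = "\<lambda>i j. bilin_apply T (axis i 1) (axis j 1)"
  show "T = bform (?t 1 1) (?t 2 1) (?t 1 2) (?t 2 2)"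
  proof (rule bilin_eqI)
    fix x y :: "real ^ 2"
    have decomp: "v = v $ 1 *\<^sub>R axis 1 1 + v $ 2 *\<^sub>R axis 2 1" for v :: "real ^ 2"
      by (simp add: vec_eq_iff forall_2 axis_def)
    have "bilin_apply T x y =
        bilin_apply T (x $ 1 *\<^sub>R axis 1 1 + x $ 2 *\<^sub>R axis 2 1) (y $ 1 *\<^sub>R axis 1 1 + y $ 2 *\<^sub>R axis 2 1)"
      by (simp flip: decomp)
    also have "\<dots> = bilin_apply (bform (?t 1 1) (?t 2 1) (?t 1 2) (?t 2 2)) x y"
      by (simp add: bform.rep_eq bilinear_ladd[OF bilinear_bilin_apply]
          bilinear_radd[OF bilinear_bilin_apply] bilinear_lmul[OF bilinear_bilin_apply]
          bilinear_rmul[OF bilinear_bilin_apply] algebra_simps)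
    finally show "bilin_apply T x y = \<dots>" .
  qed
qed

text \<open>The larger of \<open>\<bar>p + q\<bar>\<close> and \<open>\<bar>p - q\<bar>\<close> is
  \<open>\<bar>p\<bar> + \<bar>q\<bar>\<close>: a linear form on the square is largest at a
  vertex.\<close>

lemma abs_lincomb_le_1:
  fixes u v p q :: real
  assumes "\<bar>u\<bar> \<le> 1" "\<bar>v\<bar> \<le> 1" "\<bar>p + q\<bar> \<le> 1" "\<bar>p - q\<bar> \<le> 1"
  shows "\<bar>p * u + q * v\<bar> \<le> 1"
proof -
  have "\<bar>p * u + q * v\<bar> \<le> \<bar>p\<bar> * \<bar>u\<bar> + \<bar>q\<bar> * \<bar>v\<bar>"
    by (metis abs_mult abs_triangle_ineq)
  also have "\<dots> \<le> \<bar>p\<bar> * 1 + \<bar>q\<bar> * 1"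
    using assms by (intro add_mono mult_left_mono) auto
  also have "\<dots> \<le> 1"
    using assms by linarith
  finally show ?thesis .
qed

text \<open>The four expressions are the values at the vertex pairs \<open>(1, s)\<close>,
  \<open>(1, t)\<close> with \<open>s\<close>, \<open>t\<close> equal to 1 or -1. The remaining
  vertices are negatives of these and only change the sign of the value.\<close>

lemma norm_bform_le_1_iff:
  "norm (bform a b c d) \<le> 1 \<longleftrightarrow>
    \<bar>a + b + c + d\<bar> \<le> 1 \<and> \<bar>a + b - c - d\<bar> \<le> 1 \<and> \<bar>a - b + c - d\<bar> \<le> 1 \<and> \<bar>a - b - c + d\<bar> \<le> 1"
  (is "?L = ?R")
proof
  assume ?L
  have "\<bar>bilin_apply (bform a b c d) x y\<bar> \<le> 1" if "infnorm x \<le> 1" "infnorm y \<le> 1" for x y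
    using cSUP_upper[OF _ bdd_above_bilin_apply[of "bform a b c d"], of "(x, y)"] that \<open>?L\<close>
    by (simp add: norm_bilin_def)
  then have *: "\<bar>bilin_apply (bform a b c d) (vector [1, s]) (vector [1, t])\<bar> \<le> 1"
    if "\<bar>s\<bar> \<le> 1" "\<bar>t\<bar> \<le> 1" for s t
    using that by (simp add: infnorm_real2)
  show ?R
    using *[of 1 1] *[of 1 "-1"] *[of "-1" 1] *[of "-1" "-1"]
    by (simp add: bform.rep_eq algebra_simps)
next
  assume R: ?R
  have "\<bar>bilin_apply (bform a b c d) x y\<bar> \<le> 1" if "infnorm x \<le> 1" "infnorm y \<le> 1" for x y
  proof -
    have xy: "\<bar>x $ 1\<bar> \<le> 1" "\<bar>x $ 2\<bar> \<le> 1" "\<bar>y $ 1\<bar> \<le> 1" "\<bar>y $ 2\<bar> \<le> 1"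
      using that by (auto simp: infnorm_real2)
    \<comment> \<open>First \<open>x\<close> is held at the vertices \<open>(1, 1)\<close> and
      \<open>(1, -1)\<close> while \<open>y\<close> varies; these two bounds are then the hypotheses
      on \<open>p + q\<close> and \<open>p - q\<close> for the form in \<open>x\<close> with
      \<open>y\<close> fixed.\<close>
    have "\<bar>(a + b) * y $ 1 + (c + d) * y $ 2\<bar> \<le> 1"
      by (rule abs_lincomb_le_1) (use R xy in linarith)+
    moreover have "\<bar>(a - b) * y $ 1 + (c - d) * y $ 2\<bar> \<le> 1"
      by (rule abs_lincomb_le_1) (use R xy in linarith)+
    ultimately have "\<bar>(a * y $ 1 + c * y $ 2) * x $ 1 + (b * y $ 1 + d * y $ 2) * x $ 2\<bar> \<le> 1"
      using xy by (intro abs_lincomb_le_1) (simp_all add: algebra_simps)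
    then show ?thesis
      by (simp add: bform.rep_eq algebra_simps)
  qed
  then show ?L
    unfolding norm_bilin_def
    \<comment> \<open>The witness 0 shows that the supremum ranges over a nonempty set.\<close>
    by (intro cSUP_least) (auto intro: exI[of _ 0] simp: infnorm_0)
qed

lemma extreme_point_of_cball_bform_iff:
  "bform a b c d extreme_point_of cball 0 1 \<longleftrightarrow>
    \<bar>a + b + c + d\<bar> = 1 \<and> \<bar>a + b - c - d\<bar> = 1 \<and> \<bar>a - b + c - d\<bar> = 1 \<and> \<bar>a - b - c + d\<bar> = 1"
  (is "?L = ?R")
proof
  assume ?L
  then have n: "norm (bform a b c d) \<le> 1"
    and ext: "\<And>U. norm (bform a b c d + U) \<le> 1 \<Longrightarrow> norm (bform a b c d - U) \<le> 1 \<Longrightarrow> U = 0"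
    by (auto simp: extreme_point_of_cball_iff)
  \<comment> \<open>The first coefficient suffices: it equals \<open>e\<close> in each of the four
    perturbations used below.\<close>
  have U: "a' = 0" if "norm (bform (a + a') (b + b') (c + c') (d + d')) \<le> 1"
    "norm (bform (a - a') (b - b') (c - c') (d - d')) \<le> 1" for a' b' c' d'
    using ext[of "bform a' b' c' d'"] that
    by (simp add: bform_add bform_diff bform_eq_iff flip: bform_zero)
  note n = n[unfolded norm_bform_le_1_iff]
  \<comment> \<open>A vertex value of absolute value below 1 could be moved alone inside the ball.\<close>
  have sat: "\<bar>p\<bar> = 1" if "\<bar>p\<bar> \<le> 1"
    "\<And>e. \<bar>p + 4 * e\<bar> \<le> 1 \<Longrightarrow> \<bar>p - 4 * e\<bar> \<le> 1 \<Longrightarrow> e = 0" for p :: real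
  proof -
    define e where "e = (1 - \<bar>p\<bar>) / 4"
    have "\<bar>p + 4 * e\<bar> \<le> 1" "\<bar>p - 4 * e\<bar> \<le> 1"
      using that(1) by (auto simp: e_def abs_if field_simps split: if_splits)
    then have "e = 0" by (rule that(2))
    then show ?thesis by (simp add: e_def)
  qed
  have "\<bar>a + b + c + d\<bar> = 1"
  proof (rule sat)
    fix e assume "\<bar>(a + b + c + d) + 4 * e\<bar> \<le> 1" "\<bar>(a + b + c + d) - 4 * e\<bar> \<le> 1"
    then show "e = 0"
      \<comment> \<open>The perturbation copies the sign pattern of the vertex value. The four
        patterns are pairwise orthogonal, so this value moves by \<open>4 * e\<close> and the other
        three stay fixed. The next three cases do the same.\<close>
      using n by (intro U[of e e e e]) (simp_all add: norm_bform_le_1_iff algebra_simps)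
  qed (use n in blast)
  moreover have "\<bar>a + b - c - d\<bar> = 1"
  proof (rule sat)
    fix e assume "\<bar>(a + b - c - d) + 4 * e\<bar> \<le> 1" "\<bar>(a + b - c - d) - 4 * e\<bar> \<le> 1"
    then show "e = 0"
      using n by (intro U[of e e "- e" "- e"]) (simp_all add: norm_bform_le_1_iff algebra_simps)
  qed (use n in blast)
  moreover have "\<bar>a - b + c - d\<bar> = 1"
  proof (rule sat)
    fix e assume "\<bar>(a - b + c - d) + 4 * e\<bar> \<le> 1" "\<bar>(a - b + c - d) - 4 * e\<bar> \<le> 1"
    then show "e = 0"
      using n by (intro U[of e "- e" e "- e"]) (simp_all add: norm_bform_le_1_iff algebra_simps)
  qed (use n in blast)
  moreover have "\<bar>a - b - c + d\<bar> = 1"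
  proof (rule sat)
    fix e assume "\<bar>(a - b - c + d) + 4 * e\<bar> \<le> 1" "\<bar>(a - b - c + d) - 4 * e\<bar> \<le> 1"
    then show "e = 0"
      using n by (intro U[of e "- e" "- e" e]) (simp_all add: norm_bform_le_1_iff algebra_simps)
  qed (use n in blast)
  ultimately show ?R by blast
next
  assume R: ?R
  have cube: "q = 0" if "\<bar>p\<bar> = 1" "\<bar>p + q\<bar> \<le> 1" "\<bar>p - q\<bar> \<le> 1" for p q :: real
    using that by linarith
  have "U = 0" if U: "norm (bform a b c d + U) \<le> 1" "norm (bform a b c d - U) \<le> 1" for U
  proof -
    obtain a' b' c' d' where U': "U = bform a' b' c' d'"
      by (rule bform_cases)
    note U = U[unfolded U' bform_add bform_diff norm_bform_le_1_iff]
    have "a' + b' + c' + d' = 0"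
      by (rule cube[of "a + b + c + d"]) (use R U in \<open>simp_all add: algebra_simps\<close>)
    moreover have "a' + b' - c' - d' = 0"
      by (rule cube[of "a + b - c - d"]) (use R U in \<open>simp_all add: algebra_simps\<close>)
    moreover have "a' - b' + c' - d' = 0"
      by (rule cube[of "a - b + c - d"]) (use R U in \<open>simp_all add: algebra_simps\<close>)
    moreover have "a' - b' - c' + d' = 0"
      by (rule cube[of "a - b - c + d"]) (use R U in \<open>simp_all add: algebra_simps\<close>)
    \<comment> \<open>The matrix of sign patterns is invertible, so a form that vanishes at the
      vertices is zero.\<close>
    ultimately have "a' = 0 \<and> b' = 0 \<and> c' = 0 \<and> d' = 0"
      by linarith
    then show ?thesis
      by (simp add: U' bform_zero)
  qed
  with R show ?L
    by (simp add: extreme_point_of_cball_iff norm_bform_le_1_iff)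
qed

text \<open>The symmetric matrix of sign patterns has square 4 times the identity, so the same
  signed sums divided by 4 recover the coefficients. An even number of negative vertex values gives
  a signed monomial, an odd number gives four coefficients of absolute value 1/2.\<close>

lemma vertex_values_abs_1_iff:
  fixes a b c d :: real
  shows "\<bar>a + b + c + d\<bar> = 1 \<and> \<bar>a + b - c - d\<bar> = 1 \<and> \<bar>a - b + c - d\<bar> = 1 \<and> \<bar>a - b - c + d\<bar> = 1 \<longleftrightarrow>
    (\<exists>s\<in>{1, -1}. (a, b, c, d) \<in>
      {(s, 0, 0, 0), (0, s, 0, 0), (0, 0, s, 0), (0, 0, 0, s),
       (s/2, s/2, s/2, -s/2), (-s/2, s/2, s/2, s/2), (s/2, -s/2, s/2, s/2), (s/2, s/2, -s/2, s/2)})"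
  (is "?L = ?R")
proof
  assume ?L
  moreover define p q r t where "p = a + b + c + d" and "q = a + b - c - d"
    and "r = a - b + c - d" and "t = a - b - c + d"
  ultimately have signs: "p = 1 \<or> p = -1" "q = 1 \<or> q = -1" "r = 1 \<or> r = -1" "t = 1 \<or> t = -1"
    by linarith+
  have "a = (p + q + r + t) / 4" "b = (p + q - r - t) / 4"
    "c = (p - q + r - t) / 4" "d = (p - q - r + t) / 4"
    by (simp_all add: p_def q_def r_def t_def)
  with signs show ?R
    by (elim disjE; simp)
qed auto

text \<open>The index \<open>s\<close> carries the linked signs: 1 selects all upper signs, -1 all
  lower ones.\<close>

theorem theorem3p1:
  shows "bilin_apply ` {T. T extreme_point_of cball 0 1} =
    (\<Union>s\<in>{1, -1}.
      {\<lambda>x y. s * (x $ 1 * y $ 1),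
       \<lambda>x y. s * (x $ 2 * y $ 1),
       \<lambda>x y. s * (x $ 1 * y $ 2),
       \<lambda>x y. s * (x $ 2 * y $ 2),
       \<lambda>x y. 1/2 * (s * (x $ 1 * y $ 1) + s * (x $ 2 * y $ 1) + s * (x $ 1 * y $ 2) - s * (x $ 2 * y $ 2)),
       \<lambda>x y. 1/2 * (- s * (x $ 1 * y $ 1) + s * (x $ 2 * y $ 1) + s * (x $ 1 * y $ 2) + s * (x $ 2 * y $ 2)),
       \<lambda>x y. 1/2 * (s * (x $ 1 * y $ 1) - s * (x $ 2 * y $ 1) + s * (x $ 1 * y $ 2) + s * (x $ 2 * y $ 2)),
       \<lambda>x y. 1/2 * (s * (x $ 1 * y $ 1) + s * (x $ 2 * y $ 1) - s * (x $ 1 * y $ 2) + s * (x $ 2 * y $ 2))})"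
proof -
  let ?C = "\<lambda>s. {(s, 0, 0, 0), (0, s, 0, 0), (0, 0, s, 0), (0, 0, 0, s),
    (s/2, s/2, s/2, -s/2), (-s/2, s/2, s/2, s/2), (s/2, -s/2, s/2, s/2), (s/2, s/2, -s/2, s/2)}"
  let ?F = "\<lambda>k. bilin_apply (case k of (a, b, c, d) \<Rightarrow> bform a b c d)"
  \<comment> \<open>The sets are compared through coefficient tuples first;
    \<open>bilin_apply\<close> is pushed through the image only afterwards, which turns each tuple
    into the listed function.\<close>
  have "{T. T extreme_point_of cball 0 1} =
      (\<lambda>(a, b, c, d). bform a b c d) ` (\<Union>s\<in>{1, -1}. ?C s)" (is "?E = _ ` ?K")
  proof (intro set_eqI iffI)
    fix T assume "T \<in> ?E"
    moreover obtain a b c d where T: "T = bform a b c d"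
      by (rule bform_cases)
    ultimately have "(a, b, c, d) \<in> ?K"
      unfolding UN_iff
      by (simp only: mem_Collect_eq extreme_point_of_cball_bform_iff vertex_values_abs_1_iff)
    then show "T \<in> (\<lambda>(a, b, c, d). bform a b c d) ` ?K"
      unfolding T by (rule rev_image_eqI) simp
  next
    fix T assume "T \<in> (\<lambda>(a, b, c, d). bform a b c d) ` ?K"
    then obtain k where "k \<in> ?K" "T = (\<lambda>(a, b, c, d). bform a b c d) k"
      by (rule imageE)
    then obtain a b c d where "(a, b, c, d) \<in> ?K" and T: "T = bform a b c d"
      by (cases k rule: prod_cases4) (simp only: case_prod_conv)
    then show "T \<in> ?E"
      unfolding UN_iff T
      by (simp only: mem_Collect_eq extreme_point_of_cball_bform_iff vertex_values_abs_1_iff)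
  qed
  then have "bilin_apply ` ?E = (\<Union>s\<in>{1, -1}. ?F ` ?C s)"
    by (simp only: image_image image_UN)
  then show ?thesis
    by (simp add: bform.rep_eq[abs_def] algebra_simps)
qed

end
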